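(* Let $d\ge 2$, $\alpha>0$, $\kappa\in\mathbb R$, $\mu\in\mathbb S^{d-1}$, and let the random unit vector $Z\in\mathbb S^{d-1}$ have the distribution $\mathrm{GvMF}_{1,d}(\alpha,\kappa,\mu)$. Then $Z$ has the maximum entropy among all continuous random vectors $X$ on $\mathbb S^{d-1}$ (i.e. having a density with respect to $\sigma$) satisfying $$\mathbf E\left[(\mu^{T}X)^{<\alpha>}\right]=\mathbf E\left[(\mu^{T}Z)^{<\alpha>}\right];$$ that is, $H(X)\le H(Z)$ for every such $X$.
   Context: $\mathbb S^{d-1}=\{x\in\mathbb R^d:\|x\|=1\}$ and $\sigma$ is the (unnormalized) surface measure on $\mathbb S^{d-1}$, so that for unit $a$ and Borel $g\ge0$, $\int_{\mathbb S^{d-1}}g(a^{T}x)\,\sigma(dx)=\frac{2\pi^{(d-1)/2}}{\Gamma((d-1)/2)}\int_{-1}^1g(y)(1-y^2)^{(d-3)/2}dy$. Notation: $x^{<\alpha>}=|x|^\alpha\,\mathrm{sgn}(x)$ for $x\in\mathbb R$. $\mathrm{GvMF}_{1,d}(\alpha,\kappa,\mu)$ is the distribution on $\mathbb S^{d-1}$ with density with respect to $\sigma$ equal to $c_{1,d}(\kappa,\alpha)\exp\left(\frac{\kappa}{\alpha}(\mu^{T}x)^{<\alpha>}\right)$, where $c_{1,d}(\kappa,\alpha)=\left(\frac{2\pi^{(d-1)/2}}{\Gamma((d-1)/2)}\int_0^1\left(e^{\frac\kappa\alpha y^\alpha}+e^{-\frac\kappa\alpha y^\alpha}\right)(1-y^2)^{\frac{d-3}{2}}dy\right)^{-1}$.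 The entropy of a random vector $X$ on $\mathbb S^{d-1}$ with density $f$ with respect to $\sigma$ is $H(X)=-\int_{\mathbb S^{d-1}}f(x)\log f(x)\,\sigma(dx)\in[-\infty,\infty)$, the integral being taken over $\{f>0\}$. *)

theory Defs
  imports "HOL-Probability.Probability"
begin

text \<open>
  The unnormalized surface measure on the unit sphere, as the cone measure: the measure of \<open>A\<close> is
  \<open>d\<close> times the volume of the cone \<open>{t x | 0 < t < 1, x \<in> A}\<close>. Recall that \<open>sgn x = x /\<^sub>R norm x\<close>.
\<close>
definition sphere_measure :: "'a::euclidean_space measure" where
  "sphere_measure = scale_measure (of_nat DIM('a))
     (distr (restrict_space lborel (ball 0 1 - {0})) (restrict_space borel (sphere 0 1)) sgn)"

definition signed_powr :: "real \<Rightarrow> real \<Rightarrow> real" where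
  "signed_powr x \<alpha> = \<bar>x\<bar> powr \<alpha> * sgn x"

definition gvmf_const :: "nat \<Rightarrow> real \<Rightarrow> real \<Rightarrow> real" where
  "gvmf_const d \<kappa> \<alpha> =
     inverse (2 * pi powr ((real d - 1) / 2) / Gamma ((real d - 1) / 2) *
       (LBINT y:{0..1}. (exp (\<kappa> / \<alpha> * y powr \<alpha>) + exp (- (\<kappa> / \<alpha> * y powr \<alpha>))) *
          (1 - y\<^sup>2) powr ((real d - 3) / 2)))"

definition gvmf_density :: "real \<Rightarrow> real \<Rightarrow> 'a::euclidean_space \<Rightarrow> 'a \<Rightarrow> real" where
  "gvmf_density \<alpha> \<kappa> \<mu> x =
     gvmf_const DIM('a) \<kappa> \<alpha> * exp (\<kappa> / \<alpha> * signed_powr (\<mu> \<bullet> x) \<alpha>)"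

text \<open>
  The integral of \<open>- f ln f\<close> over \<open>{f > 0}\<close> as an extended real, i.e. the integral of the positive
  part minus that of the negative part (\<open>ennreal\<close> truncates negative reals to 0). Since
  \<open>- f ln f \<le> 1\<close> and the sphere has finite measure, the first integral is finite, so the
  difference is never \<open>\<infinity> - \<infinity>\<close>.
\<close>
definition density_entropy :: "('a::euclidean_space \<Rightarrow> real) \<Rightarrow> ereal" where
  "density_entropy f =
     enn2ereal (\<integral>\<^sup>+x\<in>{x. 0 < f x}. ennreal (- (f x * ln (f x))) \<partial>sphere_measure) -
     enn2ereal (\<integral>\<^sup>+x\<in>{x. 0 < f x}. ennreal (f x * ln (f x)) \<partial>sphere_measure)"

text \<open>
  Meaningful for random vectors that have a density with respect to \<^const>\<open>sphere_measure\<close>; it may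
  then be computed from any such density, see \<open>sphere_entropy_eq\<close> below.
\<close>
definition sphere_entropy :: "'w measure \<Rightarrow> ('w \<Rightarrow> 'a::euclidean_space) \<Rightarrow> ereal" where
  "sphere_entropy M X =
     density_entropy (\<lambda>x. enn2real (RN_deriv sphere_measure (distr M sphere_measure X) x))"

lemma sets_sphere_measure [measurable_cong, simp]:
  "sets (sphere_measure :: 'a::euclidean_space measure) = sets (restrict_space borel (sphere 0 1))"
  by (simp add: sphere_measure_def)

lemma space_sphere_measure [simp]:
  "space (sphere_measure :: 'a::euclidean_space measure) = sphere 0 1"
  by (subst sets_eq_imp_space_eq[OF sets_sphere_measure]) (simp add: space_restrict_space)

lemma measurable_sgn_sphere:
  "sgn \<in> measurable (restrict_space lborel (ball 0 1 - {0}))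
     (restrict_space borel (sphere 0 1 :: 'a::euclidean_space set))"
proof (rule measurable_restrict_space2)
  show "sgn \<in> space (restrict_space lborel (ball 0 1 - {0})) \<rightarrow> (sphere 0 1 :: 'a set)"
    by (auto simp: space_restrict_space norm_sgn)
  have "(\<lambda>x::'a. x /\<^sub>R norm x) \<in> borel_measurable borel"
    by measurable
  hence "(sgn :: 'a \<Rightarrow> 'a) \<in> borel_measurable borel"
    by (simp add: sgn_div_norm[abs_def])
  thus "(sgn :: 'a \<Rightarrow> 'a) \<in> borel_measurable (restrict_space lborel (ball 0 1 - {0}))"
    by (simp add: measurable_restrict_space1)
qed

lemma emeasure_sphere_measure:
  assumes "A \<in> sets (restrict_space borel (sphere 0 1 :: 'a::euclidean_space set))"
  shows "emeasure sphere_measure A =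
    of_nat DIM('a) * emeasure lborel {x \<in> ball 0 1 - {0}. sgn x \<in> A}"
proof -
  have "{x \<in> ball 0 1 - {0}. sgn x \<in> A} =
      sgn -` A \<inter> space (restrict_space lborel (ball 0 1 - {0}))"
    by (auto simp: space_restrict_space)
  with assms show ?thesis
    by (simp add: sphere_measure_def emeasure_distr[OF measurable_sgn_sphere assms]
        emeasure_restrict_space space_restrict_space)
qed

lemma emeasure_sphere_measure_sphere:
  "emeasure sphere_measure (sphere 0 1 :: 'a::euclidean_space set) =
     ennreal (2 * pi powr (DIM('a) / 2) / Gamma (DIM('a) / 2))"
proof -
  have d: "real DIM('a) > 0" by simp
  have "{x \<in> ball 0 1 - {0::'a}. sgn x \<in> sphere 0 1} = ball 0 1 - {0}"
    by (auto simp: norm_sgn)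
  moreover have "emeasure lborel (ball 0 1 - {0::'a}) = emeasure lborel (ball (0::'a) 1)"
    by (rule emeasure_Diff_null_set) (simp_all add: null_setsI)
  moreover have "sphere 0 1 \<in> sets (restrict_space borel (sphere 0 1 :: 'a set))"
    using sets.top[of "restrict_space borel (sphere 0 1 :: 'a set)"]
    by (simp only: space_restrict_space) simp
  ultimately have "emeasure sphere_measure (sphere 0 1 :: 'a set) =
      of_nat DIM('a) * ennreal (unit_ball_vol DIM('a))"
    using emeasure_ball[of 1 "0::'a"] by (simp only: emeasure_sphere_measure) simp
  also have "\<dots> = ennreal (DIM('a) * unit_ball_vol DIM('a))"
    by (simp add: ennreal_mult ennreal_of_nat_eq_real_of_nat)
  also have "DIM('a) * unit_ball_vol DIM('a) = 2 * pi powr (DIM('a) / 2) / Gamma (DIM('a) / 2)"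
  proof -
    have "real DIM('a) / 2 \<notin> \<int>\<^sub>\<le>\<^sub>0"
      using d nonpos_Ints_nonpos[of "real DIM('a) / 2"] by force
    hence "Gamma (real DIM('a) / 2 + 1) = real DIM('a) / 2 * Gamma (real DIM('a) / 2)"
      by (rule Gamma_plus1)
    thus ?thesis
      using d by (simp only: unit_ball_vol_def) simp
  qed
  finally show ?thesis .
qed

lemma finite_measure_sphere_measure:
  "finite_measure (sphere_measure :: 'a::euclidean_space measure)"
  by (rule finite_measureI) (simp add: emeasure_sphere_measure_sphere)

lemma sphere_entropy_eq:
  fixes X :: "'w \<Rightarrow> 'a::euclidean_space"
  assumes "distributed M sphere_measure X (\<lambda>x. ennreal (f x))"
    and f: "f \<in> borel_measurable sphere_measure"
  shows "sphere_entropy M X = density_entropy f"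
proof -
  interpret finite_measure "sphere_measure :: 'a measure"
    by (rule finite_measure_sphere_measure)
  define g where
    "g = (\<lambda>x. enn2real (RN_deriv sphere_measure (distr M sphere_measure X) x))"
  have "AE x in sphere_measure.
      ennreal (f x) = RN_deriv sphere_measure (distr M sphere_measure X) x"
    using assms by (intro RN_deriv_unique) (auto simp: distributed_def)
  hence "AE x in sphere_measure. g x = max 0 (f x)"
    by eventually_elim (metis g_def enn2real_ennreal ennreal_neg enn2real_0 linorder_le_cases max_def)
  hence ae: "AE x in sphere_measure. (0 < g x \<longleftrightarrow> 0 < f x) \<and> (0 < f x \<longrightarrow> g x = f x)"
    by eventually_elim auto
  have "density_entropy g = density_entropy f"
    unfolding density_entropy_def
    by (intro arg_cong2[where f = "(-)"] arg_cong[where f = enn2ereal] nn_integral_cong_AE;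
        use ae in eventually_elim) (auto simp: indicator_def)
  thus ?thesis by (simp add: sphere_entropy_def g_def)
qed

end

theory Submission
  imports Defs
begin

text \<open>
  Why the theorem holds: the logarithm of the density \<open>h\<close> of \<open>Z\<close> is an affine function
  \<open>a + b s\<close> of the statistic \<open>s x = signed_powr (\<mu> \<bullet> x) \<alpha>\<close>, whose expectation the constraint fixes.
  Hence for every density \<open>f\<close> that satisfies the constraint, the cross entropy
  \<open>- \<integral> f ln h = - (a + b \<integral> f s)\<close> has one and the same value, and for \<open>f = h\<close> this value is the
  entropy of \<open>Z\<close>. Gibbs' inequality \<open>- \<integral> f ln f \<le> - \<integral> f ln h\<close> (\<open>Gibbs_inequality\<close>) then finishes
  the proof.

  The analytic points are these. The entropy of \<open>f\<close> is either \<open>- \<infinity>\<close>, where the claim is trivial, or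
  an ordinary Lebesgue integral, because \<open>- t ln t\<close> is bounded above and the sphere has finite
  measure (\<open>density_entropy_cases\<close>). Since \<open>\<alpha> > 0\<close>, the statistic \<open>s\<close> is bounded by 1 on the
  sphere, so all cross entropies are finite. Finally, \<open>h\<close> is normalized and strictly positive because
  it is the density of a random vector: its total mass is then 1, so that the constant in front of
  the exponential cannot be \<open>\<le> 0\<close> (\<open>gvmf_const_pos\<close>).
\<close>

section \<open>Gibbs' inequality\<close>

text \<open>
  Pointwise, \<open>ln t \<le> t - 1\<close> at \<open>t = v / u\<close>.
\<close>
lemma mult_ln_le_mult_ln_self:
  fixes u v :: real
  assumes "0 \<le> u" and "0 < v"
  shows "u * ln v \<le> u * ln u + (v - u)"
proof (cases "u = 0")
  case True
  then show ?thesis using assms by simp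
next
  case False
  with assms have u: "0 < u" by simp
  have "u * (ln v - ln u) \<le> u * (v / u - 1)"
    using u assms(2) ln_le_minus_one[of "v / u"]
    by (intro mult_left_mono) (simp_all add: ln_div)
  also have "\<dots> = v - u"
    using u by (simp add: field_simps)
  finally show ?thesis by (simp add: algebra_simps)
qed

lemma Gibbs_inequality:
  fixes f h :: "'a \<Rightarrow> real"
  assumes "integrable S f" and "integrable S h"
    and "integral\<^sup>L S f = integral\<^sup>L S h"
    and "integrable S (\<lambda>x. f x * ln (f x))" and "integrable S (\<lambda>x. f x * ln (h x))"
    and "\<And>x. 0 \<le> f x" and "\<And>x. 0 < h x"
  shows "(\<integral>x. f x * ln (h x) \<partial>S) \<le> (\<integral>x. f x * ln (f x) \<partial>S)"
proof -
  have "(\<integral>x. f x * ln (h x) \<partial>S) \<le> (\<integral>x. f x * ln (f x) + (h x - f x) \<partial>S)"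
    using assms by (intro integral_mono mult_ln_le_mult_ln_self) simp_all
  also have "\<dots> = (\<integral>x. f x * ln (f x) \<partial>S)"
    using assms by simp
  finally show ?thesis .
qed

section \<open>Entropy as a Lebesgue integral\<close>

lemma density_entropy_eq_nn_integral:
  fixes f :: "'a::euclidean_space \<Rightarrow> real"
  assumes nonneg: "\<And>x. 0 \<le> f x"
  shows "density_entropy f =
    enn2ereal (\<integral>\<^sup>+x. ennreal (- (f x * ln (f x))) \<partial>sphere_measure) -
    enn2ereal (\<integral>\<^sup>+x. ennreal (f x * ln (f x)) \<partial>sphere_measure)"
proof -
  (* Outside of {f > 0} the integrand is 0 * ln 0 = 0. *)
  have zero: "f x = 0" if "\<not> 0 < f x" for x
    using nonneg[of x] that by simp
  show ?thesis
    unfolding density_entropy_def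
    by (intro arg_cong2[where f = "(-)"] arg_cong[where f = enn2ereal] nn_integral_cong)
      (auto simp: indicator_def zero)
qed

lemma density_entropy_eq_integral:
  fixes f :: "'a::euclidean_space \<Rightarrow> real"
  assumes int: "integrable sphere_measure (\<lambda>x. f x * ln (f x))" and "\<And>x. 0 \<le> f x"
  shows "density_entropy f = ereal (- (\<integral>x. f x * ln (f x) \<partial>sphere_measure))"
proof -
  have fin: "enn2ereal p = ereal (enn2real p)" if "p \<noteq> \<infinity>" for p
    using that by (cases p) simp_all
  show ?thesis
    using int
    by (simp add: density_entropy_eq_nn_integral assms(2) real_lebesgue_integral_def[OF int]
        real_integrable_def fin)
qed

text \<open>
  The positive part of \<open>- f ln f\<close> has a finite integral because \<open>- t ln t \<le> 1\<close> for \<open>t > 0\<close>; so only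
  its negative part can make the entropy infinite.
\<close>
lemma density_entropy_cases:
  fixes f :: "'a::euclidean_space \<Rightarrow> real"
  assumes "f \<in> borel_measurable sphere_measure" and nonneg: "\<And>x. 0 \<le> f x"
  obtains "density_entropy f = - \<infinity>"
  | "integrable sphere_measure (\<lambda>x. f x * ln (f x))"
proof -
  let ?P = "\<integral>\<^sup>+x. ennreal (- (f x * ln (f x))) \<partial>sphere_measure"
  let ?Q = "\<integral>\<^sup>+x. ennreal (f x * ln (f x)) \<partial>sphere_measure"
  have le1: "- (f x * ln (f x)) \<le> 1" for x
    using mult_ln_le_mult_ln_self[OF nonneg[of x], of 1] nonneg[of x] by simp
  have "?P \<le> (\<integral>\<^sup>+x. 1 \<partial>(sphere_measure :: 'a measure))"
    using le1 by (intro nn_integral_mono) simp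
  also have "\<dots> < \<infinity>"
    by (simp add: emeasure_sphere_measure_sphere)
  finally have P: "?P < \<infinity>" .
  show thesis
  proof (cases "?Q = \<infinity>")
    case True
    with P have "density_entropy f = - \<infinity>"
      unfolding density_entropy_eq_nn_integral[OF nonneg]
      by (cases ?P) (simp_all add: top_ereal_def)
    then show thesis by (rule that(1))
  next
    case False
    with P have "integrable sphere_measure (\<lambda>x. f x * ln (f x))"
      using assms(1) by (simp add: real_integrable_def)
    then show thesis by (rule that(2))
  qed
qed

section \<open>Densities of random vectors\<close>

lemma (in prob_space) nn_integral_distributed_density:
  assumes "distributed M S X f"
  shows "(\<integral>\<^sup>+x. f x \<partial>S) = 1"
  using distributed_nn_integral[OF assms, of "\<lambda>_. 1"] by (simp add: emeasure_space_1)

lemma (in prob_space) distributed_real_density: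
  assumes f: "distributed M S X f"
  obtains g :: "'b \<Rightarrow> real" where "g \<in> borel_measurable S" and "\<And>x. 0 \<le> g x"
    and "distributed M S X (\<lambda>x. ennreal (g x))"
proof -
  have [measurable]: "f \<in> borel_measurable S"
    using f by (rule distributed_borel_measurable)
  have "AE x in S. f x \<noteq> \<infinity>"
    by (rule nn_integral_PInf_AE) (simp_all add: nn_integral_distributed_density[OF f])
  then have "AE x in S. f x = ennreal (enn2real (f x))"
    by eventually_elim (simp add: less_top)
  then have "distributed M S X (\<lambda>x. ennreal (enn2real (f x)))"
    using f by (subst (asm) distributed_cong_density) simp_all
  then show thesis
    by (rule that[rotated 2]) simp_all
qed

lemma (in prob_space) integrable_distributed_density:
  fixes f :: "'b \<Rightarrow> real"
  assumes "distributed M S X (\<lambda>x. ennreal (f x))"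
    and "f \<in> borel_measurable S" and "\<And>x. 0 \<le> f x"
  shows "integrable S f" and "integral\<^sup>L S f = 1"
proof -
  have "(\<integral>\<^sup>+x. ennreal (f x) \<partial>S) = ennreal 1"
    using nn_integral_distributed_density[OF assms(1)] by simp
  then show "integrable S f" and "integral\<^sup>L S f = 1"
    using assms nn_integral_eq_integrable[of f S 1] by simp_all
qed

section \<open>The generalized von Mises-Fisher density\<close>

lemma measurable_signed_powr_inner [measurable]:
  fixes \<mu> :: "'a::euclidean_space"
  shows "(\<lambda>x. signed_powr (\<mu> \<bullet> x) \<alpha>) \<in> borel_measurable sphere_measure"
proof -
  have "(\<lambda>x. signed_powr (\<mu> \<bullet> x) \<alpha>) \<in> borel_measurable borel"
    unfolding signed_powr_def sgn_if by measurable
  then have "(\<lambda>x. signed_powr (\<mu> \<bullet> x) \<alpha>) \<in> borel_measurable (restrict_space borel (sphere 0 1))"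
    by (rule measurable_restrict_space1)
  then show ?thesis
    by (simp cong: measurable_cong_sets)
qed

lemma abs_signed_powr_inner_le_1:
  fixes \<mu> x :: "'a::euclidean_space"
  assumes "norm \<mu> = 1" and "norm x = 1" and "0 < \<alpha>"
  shows "\<bar>signed_powr (\<mu> \<bullet> x) \<alpha>\<bar> \<le> 1"
proof -
  have "\<bar>\<mu> \<bullet> x\<bar> \<le> 1"
    using Cauchy_Schwarz_ineq2[of \<mu> x] assms by simp
  then have "\<bar>\<mu> \<bullet> x\<bar> powr \<alpha> \<le> 1"
    using assms(3) by (simp add: powr_le1)
  then show ?thesis
    by (simp add: signed_powr_def abs_mult abs_sgn_eq)
qed

text \<open>
  With a nonpositive constant the density, truncated to \<open>ennreal\<close>, would be 0, which has total mass 0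
  instead of 1.
\<close>
lemma (in prob_space) gvmf_const_pos:
  fixes Z :: "'a \<Rightarrow> 'b::euclidean_space"
  assumes Z: "distributed M sphere_measure Z (\<lambda>x. ennreal (gvmf_density \<alpha> \<kappa> \<mu> x))"
  shows "0 < gvmf_const DIM('b) \<kappa> \<alpha>"
proof (rule ccontr)
  assume "\<not> 0 < gvmf_const DIM('b) \<kappa> \<alpha>"
  then have "ennreal (gvmf_density \<alpha> \<kappa> \<mu> x) = 0" for x :: 'b
    by (simp add: gvmf_density_def ennreal_neg mult_nonpos_nonneg)
  then show False
    using nn_integral_distributed_density[OF Z] by simp
qed

text \<open>
  The cross entropy of \<open>X\<close> relative to the von Mises-Fisher density depends on \<open>X\<close> only through the
  expectation that the constraint prescribes.
\<close>
lemma (in prob_space) gvmf_cross_entropy: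
  fixes X :: "'a \<Rightarrow> 'b::euclidean_space" and f :: "'b \<Rightarrow> real"
  assumes X: "distributed M sphere_measure X (\<lambda>x. ennreal (f x))"
    and f [measurable]: "f \<in> borel_measurable sphere_measure" and nonneg: "\<And>x. 0 \<le> f x"
    and c: "0 < gvmf_const DIM('b) \<kappa> \<alpha>" and \<alpha>: "0 < \<alpha>" and \<mu>: "norm \<mu> = 1"
  shows "integrable sphere_measure (\<lambda>x. f x * ln (gvmf_density \<alpha> \<kappa> \<mu> x))" (is ?int)
    and "(\<integral>x. f x * ln (gvmf_density \<alpha> \<kappa> \<mu> x) \<partial>sphere_measure) =
      ln (gvmf_const DIM('b) \<kappa> \<alpha>) + \<kappa> / \<alpha> * (\<integral>\<omega>. signed_powr (\<mu> \<bullet> X \<omega>) \<alpha> \<partial>M)" (is ?eq)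
proof -
  let ?c = "ln (gvmf_const DIM('b) \<kappa> \<alpha>)"
  let ?s = "\<lambda>x. signed_powr (\<mu> \<bullet> x) \<alpha>"
  note int_f = integrable_distributed_density[OF X f nonneg]
  have split: "f x * ln (gvmf_density \<alpha> \<kappa> \<mu> x) = ?c * f x + \<kappa> / \<alpha> * (f x * ?s x)" for x
    using c by (simp add: gvmf_density_def ln_mult algebra_simps)
  have int_fs: "integrable sphere_measure (\<lambda>x. f x * ?s x)"
  proof (rule Bochner_Integration.integrable_bound[OF int_f(1)])
    show "AE x in sphere_measure. norm (f x * ?s x) \<le> norm (f x)"
      using abs_signed_powr_inner_le_1[OF \<mu> _ \<alpha>]
      by (intro AE_I2) (simp add: abs_mult mult_left_le)
  qed measurable
  show ?int
    unfolding split using int_f(1) int_fs by simp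
  show ?eq
    unfolding split using int_f int_fs distributed_integral[OF X, of ?s] nonneg by simp
qed

section \<open>Maximum entropy\<close>

theorem theorem4p2:
  fixes \<alpha> \<kappa> :: real and \<mu> :: "real ^ 'n"
    and M :: "'v measure" and Z :: "'v \<Rightarrow> real ^ 'n"
    and N :: "'w measure" and X :: "'w \<Rightarrow> real ^ 'n"
  assumes "CARD('n) \<ge> 2" and "\<alpha> > 0" and "\<mu> \<in> sphere 0 1"
    and "prob_space M"
    and "distributed M sphere_measure Z (\<lambda>x. ennreal (gvmf_density \<alpha> \<kappa> \<mu> x))"
    and "prob_space N"
    and "\<exists>f. distributed N sphere_measure X f"
    and "(\<integral>\<omega>. signed_powr (\<mu> \<bullet> X \<omega>) \<alpha> \<partial>N) = (\<integral>\<omega>. signed_powr (\<mu> \<bullet> Z \<omega>) \<alpha> \<partial>M)"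
  shows "sphere_entropy N X \<le> sphere_entropy M Z"
proof -
  interpret M: prob_space M by fact
  interpret N: prob_space N by fact
  let ?h = "gvmf_density \<alpha> \<kappa> \<mu> :: real ^ 'n \<Rightarrow> real"
  let ?S = "sphere_measure :: (real ^ 'n) measure"
  note Z = assms(5)
  have \<mu>: "norm \<mu> = 1" using assms(3) by simp
  note c = M.gvmf_const_pos[OF Z]
  have h: "?h \<in> borel_measurable ?S"
    unfolding gvmf_density_def by measurable
  have h_pos: "0 < ?h x" for x
    using c by (simp add: gvmf_density_def)
  note h_nonneg = less_imp_le[OF h_pos]
  obtain f where f: "f \<in> borel_measurable ?S" and f_nonneg: "\<And>x. 0 \<le> f x"
    and X: "distributed N ?S X (\<lambda>x. ennreal (f x))"
    using assms(7) N.distributed_real_density by metis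
  note cross_X = N.gvmf_cross_entropy[OF X f f_nonneg c assms(2) \<mu>]
  note cross_Z = M.gvmf_cross_entropy[OF Z h h_nonneg c assms(2) \<mu>]
  have cross: "(\<integral>x. f x * ln (?h x) \<partial>?S) = (\<integral>x. ?h x * ln (?h x) \<partial>?S)"
    unfolding cross_X(2) cross_Z(2) assms(8) ..
  have "density_entropy f \<le> density_entropy ?h"
    using f f_nonneg
  proof (cases rule: density_entropy_cases)
    case 1
    then show ?thesis by simp
  next
    case 2
    have "(\<integral>x. f x * ln (?h x) \<partial>?S) \<le> (\<integral>x. f x * ln (f x) \<partial>?S)"
      using N.integrable_distributed_density[OF X f f_nonneg]
        M.integrable_distributed_density[OF Z h h_nonneg] 2 cross_X(1) f_nonneg h_pos
      by (intro Gibbs_inequality) simp_all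
    then show ?thesis
      unfolding cross
      by (simp add: density_entropy_eq_integral[OF 2 f_nonneg]
          density_entropy_eq_integral[OF cross_Z(1) h_nonneg])
  qed
  then show ?thesis
    using sphere_entropy_eq[OF X f] sphere_entropy_eq[OF Z h] by simp
qed

end
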